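(* For any $n\geq 2$ we have $\theta(P_n)=\lceil\frac n2\rceil+1$.
   Context: $P_n$ is the path on $n$ vertices. A vertex coloring of a graph $G$ (not necessarily proper) is distinguishing if the only automorphism of $G$ preserving the color of every vertex is the identity. The distinguishing threshold $\theta(G)$ is the minimum positive integer $t$ such that for every $k\geq t$, every coloring of $G$ with exactly $k$ colors (all $k$ used) is distinguishing. *)

theory Defs
  imports Complex_Main
begin

record 'a graph =
  verts :: "'a set"
  edges :: "'a set set"

definition simple_graph :: "'a graph \<Rightarrow> bool" where
  "simple_graph G \<longleftrightarrow> finite (verts G) \<and>
     edges G \<subseteq> {{u, v} |u v. u \<in> verts G \<and> v \<in> verts G \<and> u \<noteq> v}"

definition automorphism :: "'a graph \<Rightarrow> ('a \<Rightarrow> 'a) \<Rightarrow> bool" where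
  "automorphism G f \<longleftrightarrow> bij_betw f (verts G) (verts G) \<and>
     (\<forall>u\<in>verts G. \<forall>v\<in>verts G. {f u, f v} \<in> edges G \<longleftrightarrow> {u, v} \<in> edges G)"

text \<open>Maps are total functions on the ambient type; only their values on the vertex set
  matter, so being the identity is required on the vertices only.\<close>

definition distinguishing :: "'a graph \<Rightarrow> ('a \<Rightarrow> 'c) \<Rightarrow> bool" where
  "distinguishing G c \<longleftrightarrow>
     (\<forall>f. automorphism G f \<and> (\<forall>v\<in>verts G. c (f v) = c v) \<longrightarrow> (\<forall>v\<in>verts G. f v = v))"

text \<open>Colors are natural numbers; which names are used is irrelevant, only the number of
  colors that actually occur. If no coloring with exactly \<open>k\<close> colors exists
  (\<open>k\<close> exceeds the number of vertices), the condition for \<open>k\<close> holds vacuously.\<close>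

definition forces_distinguishing :: "'a graph \<Rightarrow> nat \<Rightarrow> bool" where
  "forces_distinguishing G t \<longleftrightarrow>
     (\<forall>k\<ge>t. \<forall>c :: 'a \<Rightarrow> nat. card (c ` verts G) = k \<longrightarrow> distinguishing G c)"

definition distinguishing_threshold :: "'a graph \<Rightarrow> nat" where
  "distinguishing_threshold G = (LEAST t. t \<ge> 1 \<and> forces_distinguishing G t)"

text \<open>The minimum is taken over a nonempty set.\<close>

lemma forces_distinguishing_exists:
  assumes "simple_graph G"
  shows "\<exists>t\<ge>1. forces_distinguishing G t"
proof (intro exI conjI)
  show "forces_distinguishing G (card (verts G) + 1)"
    using assms card_image_le[of "verts G"]
    by (fastforce simp: forces_distinguishing_def simple_graph_def dest: le_trans)
qed simp

definition path_graph :: "nat \<Rightarrow> nat graph" where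
  "path_graph n = \<lparr>verts = {1..n}, edges = {{i, i + 1} |i. 1 \<le> i \<and> i + 1 \<le> n}\<rparr>"

lemma simple_graph_path_graph: "simple_graph (path_graph n)"
  by (fastforce simp: simple_graph_def path_graph_def)

end

theory Submission
  imports Defs
begin

text \<open>An automorphism of a path maps end vertices to end vertices, because an end vertex has only
  one neighbor. An automorphism fixing the first vertex fixes every vertex, by moving along the
  path; one sending the first vertex to the last becomes of this kind after composition with the
  reflection \<open>i \<mapsto> n + 1 - i\<close>. So the reflection is the only nontrivial automorphism
  (\<open>automorphism_path_graph_cases\<close>).

  Hence a coloring fails to be distinguishing only if it is constant on the orbits of the
  reflection. There are \<open>\<lceil>n/2\<rceil>\<close> orbits, so such a coloring has at most that many colors
  (\<open>card_colors_le_if_not_distinguishing\<close>). Conversely, giving each orbit its own color attains this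
  number with a coloring that is not distinguishing (\<open>not_distinguishing_orbit_coloring\<close>), since
  the reflection moves the vertex 1 as soon as \<open>n \<ge> 2\<close>.\<close>

lemma path_graph_edge_iff:
  assumes "u \<in> {1..n}" "v \<in> {1..n}"
  shows "{u, v} \<in> edges (path_graph n) \<longleftrightarrow> v = u + 1 \<or> u = v + 1"
  using assms by (fastforce simp: path_graph_def doubleton_eq_iff)

lemma automorphism_path_graph_iff:
  "automorphism (path_graph n) f \<longleftrightarrow> bij_betw f {1..n} {1..n} \<and>
     (\<forall>u\<in>{1..n}. \<forall>v\<in>{1..n}. (f v = f u + 1 \<or> f u = f v + 1) \<longleftrightarrow> (v = u + 1 \<or> u = v + 1))"
proof -
  have verts: "verts (path_graph n) = {1..n}"
    by (simp add: path_graph_def)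
  show ?thesis
    unfolding automorphism_def verts
    by (intro conj_cong refl ball_cong)
      (simp only: path_graph_edge_iff bij_betw_apply)
qed

lemma automorphism_comp:
  assumes "automorphism G f" "automorphism G g"
  shows "automorphism G (g \<circ> f)"
  using assms bij_betw_trans[of f "verts G" "verts G" g "verts G"]
  by (auto simp: automorphism_def bij_betwE)

definition path_reflection :: "nat \<Rightarrow> nat \<Rightarrow> nat" where
  "path_reflection n i = n + 1 - i"

lemma automorphism_path_reflection: "automorphism (path_graph n) (path_reflection n)"
proof -
  have "bij_betw (path_reflection n) {1..n} {1..n}"
    by (rule bij_betw_byWitness[where f' = "path_reflection n"]) (auto simp: path_reflection_def)
  then show ?thesis
    by (auto simp: automorphism_path_graph_iff path_reflection_def)
qed

text \<open>An inner vertex \<open>f 1\<close> would have two neighbors, both of which would have to be the image of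
  the only neighbor 2 of the vertex 1.\<close>

lemma automorphism_path_graph_first:
  assumes aut: "automorphism (path_graph n) f" and "n \<ge> 1"
  shows "f 1 = 1 \<or> f 1 = n"
proof (rule ccontr)
  assume not_end: "\<not> (f 1 = 1 \<or> f 1 = n)"
  have bij: "bij_betw f {1..n} {1..n}"
    and adj: "\<And>u v. u \<in> {1..n} \<Longrightarrow> v \<in> {1..n} \<Longrightarrow>
      (f v = f u + 1 \<or> f u = f v + 1) \<longleftrightarrow> (v = u + 1 \<or> u = v + 1)"
    using aut by (auto simp: automorphism_path_graph_iff)
  have one: "1 \<in> {1..n}"
    using \<open>n \<ge> 1\<close> by simp
  have "f 1 \<in> {1..n}"
    using bij one by (rule bij_betw_apply)
  then have "f 1 - 1 \<in> f ` {1..n}" "f 1 + 1 \<in> f ` {1..n}"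
    using not_end bij_betw_imp_surj_on[OF bij] by auto
  then obtain a b where ab: "a \<in> {1..n}" "f a = f 1 - 1" "b \<in> {1..n}" "f b = f 1 + 1"
    by (metis imageE)
  have "a = 2" "b = 2"
    using adj[OF one ab(1)] adj[OF one ab(3)] ab \<open>f 1 \<in> {1..n}\<close> by auto
  then show False
    using ab by simp
qed

text \<open>If \<open>f\<close> fixes \<open>1, \<dots>, i\<close>, then \<open>f (i + 1)\<close> is a neighbor of \<open>i\<close>, and by injectivity it is not
  \<open>i - 1\<close>.\<close>

lemma automorphism_path_graph_fixing_first:
  assumes aut: "automorphism (path_graph n) f" and first: "f 1 = 1" and "i \<in> {1..n}"
  shows "f i = i"
  using \<open>i \<in> {1..n}\<close>
proof (induction i rule: less_induct)
  case (less i)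
  have bij: "bij_betw f {1..n} {1..n}"
    and adj: "\<And>u v. u \<in> {1..n} \<Longrightarrow> v \<in> {1..n} \<Longrightarrow>
      (f v = f u + 1 \<or> f u = f v + 1) \<longleftrightarrow> (v = u + 1 \<or> u = v + 1)"
    using aut by (auto simp: automorphism_path_graph_iff)
  show ?case
  proof (cases "i = 1")
    case True
    then show ?thesis
      using first by simp
  next
    case False
    then have prev: "i - 1 \<in> {1..n}" and fixed: "f (i - 1) = i - 1"
      using less by auto
    have "f i = i \<or> f i = i - 2"
      using adj[OF prev less.prems] fixed less.prems by auto
    moreover have "f i \<noteq> i - 2"
    proof
      assume eq: "f i = i - 2"
      have "f i \<in> {1..n}"
        using bij less.prems by (rule bij_betw_apply)
      then have prev2: "i - 2 \<in> {1..n}"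
        using eq by simp
      then have "f (i - 2) = f i"
        using less.IH[of "i - 2"] eq less.prems by simp
      then have "i - 2 = i"
        using bij_betw_imp_inj_on[OF bij] prev2 less.prems by (meson inj_onD)
      then show False
        using less.prems unfolding atLeastAtMost_iff by linarith
    qed
    ultimately show ?thesis
      by blast
  qed
qed

lemma automorphism_path_graph_cases:
  assumes aut: "automorphism (path_graph n) f"
  shows "(\<forall>i\<in>{1..n}. f i = i) \<or> (\<forall>i\<in>{1..n}. f i = path_reflection n i)"
proof (cases "n \<ge> 1 \<and> f 1 = n")
  case True
  let ?g = "path_reflection n \<circ> f"
  have "automorphism (path_graph n) ?g"
    using aut automorphism_path_reflection by (rule automorphism_comp)
  moreover have "?g 1 = 1"
    using True by (simp add: path_reflection_def)
  ultimately have "\<forall>i\<in>{1..n}. path_reflection n (f i) = i"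
    using automorphism_path_graph_fixing_first[of n ?g] by simp
  moreover have "\<forall>i\<in>{1..n}. f i \<in> {1..n}"
    using aut unfolding automorphism_path_graph_iff by (blast dest: bij_betwE)
  ultimately have "\<forall>i\<in>{1..n}. f i = path_reflection n i"
    by (fastforce simp: path_reflection_def)
  then show ?thesis ..
next
  case False
  then show ?thesis
    using automorphism_path_graph_first[OF aut] automorphism_path_graph_fixing_first[OF aut]
    by fastforce
qed

text \<open>A nontrivial automorphism preserving the colors can only be the reflection, so the first half
  of the path, with the middle vertex if there is one, already shows all the colors.\<close>

lemma card_colors_le_if_not_distinguishing:
  assumes "\<not> distinguishing (path_graph n) c"
  shows "card (c ` {1..n}) \<le> (n + 1) div 2"
proof -
  have verts: "verts (path_graph n) = {1..n}"
    by (simp add: path_graph_def)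
  obtain f where aut: "automorphism (path_graph n) f"
    and color: "\<forall>i\<in>{1..n}. c (f i) = c i" and moves: "\<not> (\<forall>i\<in>{1..n}. f i = i)"
    using assms unfolding distinguishing_def verts by blast
  have "\<forall>i\<in>{1..n}. f i = path_reflection n i"
    using automorphism_path_graph_cases[OF aut] moves by blast
  with color have symmetric: "\<forall>i\<in>{1..n}. c (path_reflection n i) = c i"
    by simp
  have "c ` {1..n} \<subseteq> c ` {1..(n + 1) div 2}"
  proof (rule image_subsetI)
    fix i assume i: "i \<in> {1..n}"
    show "c i \<in> c ` {1..(n + 1) div 2}"
    proof (cases "i \<le> (n + 1) div 2")
      case True
      then show ?thesis
        using i by simp
    next
      case False
      then have "path_reflection n i \<in> {1..(n + 1) div 2}"
        using i by (auto simp: path_reflection_def)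
      then show ?thesis
        using symmetric i by (metis imageI)
    qed
  qed
  then have "card (c ` {1..n}) \<le> card (c ` {1..(n + 1) div 2})"
    by (intro card_mono) simp_all
  also have "\<dots> \<le> (n + 1) div 2"
    using card_image_le[of "{1..(n + 1) div 2}" c] by simp
  finally show ?thesis .
qed

text \<open>The color \<open>min i (n + 1 - i)\<close> of a vertex names its orbit under the reflection by the smaller
  member.\<close>

lemma not_distinguishing_orbit_coloring:
  assumes "n \<ge> 2"
  shows "\<not> distinguishing (path_graph n) (\<lambda>i. min i (path_reflection n i))"
proof
  assume "distinguishing (path_graph n) (\<lambda>i. min i (path_reflection n i))"
  then have "\<forall>i\<in>{1..n}. path_reflection n i = i"
    using automorphism_path_reflection[of n]
    by (auto simp: distinguishing_def path_graph_def path_reflection_def)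
  then have "path_reflection n 1 = 1"
    using assms by simp
  then show False
    using assms by (simp add: path_reflection_def)
qed

lemma card_orbit_coloring:
  "card ((\<lambda>i. min i (path_reflection n i)) ` {1..n}) = (n + 1) div 2"
proof -
  have "(\<lambda>i. min i (path_reflection n i)) ` {1..n} = {1..(n + 1) div 2}"
  proof
    show "(\<lambda>i. min i (path_reflection n i)) ` {1..n} \<subseteq> {1..(n + 1) div 2}"
      by (auto simp: path_reflection_def min_def)
    show "{1..(n + 1) div 2} \<subseteq> (\<lambda>i. min i (path_reflection n i)) ` {1..n}"
    proof
      fix i assume "i \<in> {1..(n + 1) div 2}"
      then have "i \<in> {1..n}" "i = min i (path_reflection n i)"
        by (auto simp: path_reflection_def)
      then show "i \<in> (\<lambda>i. min i (path_reflection n i)) ` {1..n}"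
        by blast
    qed
  qed
  then show ?thesis
    by simp
qed

theorem proposition3p2:
  fixes n :: nat
  assumes "n \<ge> 2"
  shows "int (distinguishing_threshold (path_graph n)) = \<lceil>real n / 2\<rceil> + 1"
proof -
  have verts: "verts (path_graph n) = {1..n}"
    by (simp add: path_graph_def)
  have "distinguishing_threshold (path_graph n) = (n + 1) div 2 + 1"
    unfolding distinguishing_threshold_def
  proof (rule Least_equality)
    show "(n + 1) div 2 + 1 \<ge> 1 \<and> forces_distinguishing (path_graph n) ((n + 1) div 2 + 1)"
      using card_colors_le_if_not_distinguishing[of n]
      by (fastforce simp: forces_distinguishing_def verts)
  next
    fix t assume "t \<ge> 1 \<and> forces_distinguishing (path_graph n) t"
    then show "(n + 1) div 2 + 1 \<le> t"
      using not_distinguishing_orbit_coloring[OF assms] card_orbit_coloring[of n]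
      unfolding forces_distinguishing_def verts
      by (metis Suc_eq_plus1 not_less_eq_eq)
  qed
  moreover have "\<lceil>real n / 2\<rceil> = int ((n + 1) div 2)"
    by (rule ceiling_unique) linarith+
  ultimately show ?thesis
    by simp
qed

end
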